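(* Let $\rho_0 \in [0,1]$ be arbitrary but fixed, and put $a := \frac{3-\rho_0}{3+\rho_0} \in [\frac12,1]$. Let $\mathcal{A}^\rho_{\rho_0}$ be the set of all Pickands dependence functions $A$ with $\rho(C_A)=\rho_0$. Then every $A \in \mathcal{A}^\rho_{\rho_0}$ satisfies $$L_{a}(t) \le A(t) \le U_{\rho_0}(t) \quad \text{for all } t \in [0,1].$$ Additionally, the set $$\Omega^\rho_{\rho_0} := \big\{(t,y) \in [0,1]\times[\tfrac12,1] : L_{a}(t) \le y \le U_{\rho_0}(t)\big\}$$ is best possible in the sense that for each point $(t,y) \in \Omega^\rho_{\rho_0}$ there exists some $A \in \mathcal{A}^\rho_{\rho_0}$ with $A(t)=y$.
   Context: A Pickands dependence function is a convex function $A:[0,1]\to[\frac12,1]$ with $\max\{t,1-t\}\le A(t)\le 1$ for all $t\in[0,1]$; $\mathcal{A}$ denotes the set of all of them. The extreme-value copula $C_A$ corresponding to $A\in\mathcal{A}$ is $$C_A(x,y)=(xy)^{A\left(\frac{\ln x}{\ln (xy)}\right)}, \qquad x,y\in(0,1),$$ extended to $[0,1]^2$ by continuity. Its Spearman $\rho$ is $$\rho(C_A) = -3+12\int_{[0,1]}\frac{1}{(1+A(t))^2}\,d\lambda(t),$$ where $\lambda$ is Lebesgue measure (this coincides with the usual definition $\rho(C)=12\int_{[0,1]^2}C\,d\lambda_2-3$). For $y\in[\frac12,1]$ the function $L_y\in\mathcal{A}$ is defined by $$L_y(t)=\begin{cases}1-t & \text{if } t\in[0,1-y],\\ y & \text{if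 } t\in(1-y,y],\\ t & \text{if } t\in(y,1].\end{cases}$$ For $x\in[0,\frac12]$ and $y\in[\frac12,1]$ the function $P_{x,y}\in\mathcal{A}$ is defined by $$P_{x,y}(t)=\begin{cases}1-t & \text{if } t\in[0,x],\\ \frac{1-x-y}{x-y}(t-y)+y & \text{if } t\in(x,y],\\ t & \text{if } t\in(y,1]\end{cases}$$ (for $x=y=\frac12$ the middle case is empty). For $\rho_0\in[0,1]$ and $a=\frac{3-\rho_0}{3+\rho_0}$, the function $U_{\rho_0}:[0,1]\to[\frac12,1]$ is defined by $$U_{\rho_0}(t)=\begin{cases}P_{0,a}(t) & \text{if } t\in\big[0,\frac{3-\rho_0}{6+\rho_0}\big),\\[2pt] \dfrac{9-\rho_0+4\sqrt{6-2\rho_0-15t(1-t)-\rho_0t(1-t)}}{15+\rho_0} & \text{if } t\in\big[\frac{3-\rho_0}{6+\rho_0},\frac{3+2\rho_0}{6+\rho_0}\big],\\[2pt] P_{1-a,1}(t) & \text{if } t\in\big(\frac{3+2\rho_0}{6+\rho_0},1\big].\end{cases}$$ *)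

theory Defs
  imports "HOL-Analysis.Analysis"
begin

text \<open>Functions on \<open>[0,1]\<close> are rendered as total functions on the reals whose
  values outside \<open>[0,1]\<close> are irrelevant.\<close>

definition pickands :: "(real \<Rightarrow> real) set" where
  "pickands = {A. A \<in> {0..1} \<rightarrow> {1/2..1} \<and> convex_on {0..1} A \<and>
                  (\<forall>t\<in>{0..1}. max t (1 - t) \<le> A t \<and> A t \<le> 1)}"

text \<open>On the boundary of the unit square the continuous extension of
  \<open>(x y) powr A (ln x / ln (x y))\<close> is \<open>min x y\<close>; lemma \<open>continuous_on_ev_copula\<close>
  confirms that this is the extension by continuity.\<close>

definition ev_copula :: "(real \<Rightarrow> real) \<Rightarrow> real \<Rightarrow> real \<Rightarrow> real" where
  "ev_copula A x y =
     (if x \<in> {0<..<1} \<and> y \<in> {0<..<1} then (x * y) powr A (ln x / ln (x * y)) else min x y)"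

definition spearman_rho :: "(real \<Rightarrow> real \<Rightarrow> real) \<Rightarrow> real" where
  "spearman_rho C = 12 * (LINT z : {0..1} \<times> {0..1} | lborel. C (fst z) (snd z)) - 3"

definition pickands_rho :: "real \<Rightarrow> (real \<Rightarrow> real) set" where
  "pickands_rho r = {A \<in> pickands. spearman_rho (ev_copula A) = r}"

definition L_fun :: "real \<Rightarrow> real \<Rightarrow> real" where
  "L_fun y t = (if t \<le> 1 - y then 1 - t else if t \<le> y then y else t)"

definition P_fun :: "real \<Rightarrow> real \<Rightarrow> real \<Rightarrow> real" where
  "P_fun x y t = (if t \<le> x then 1 - t
                  else if t \<le> y then (1 - x - y) / (x - y) * (t - y) + y
                  else t)"

definition U_fun :: "real \<Rightarrow> real \<Rightarrow> real" where
  "U_fun r t = (let a = (3 - r) / (3 + r) in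
     if t < (3 - r) / (6 + r) then P_fun 0 a t
     else if t \<le> (3 + 2 * r) / (6 + r)
       then (9 - r + 4 * sqrt (6 - 2 * r - 15 * t * (1 - t) - r * t * (1 - t))) / (15 + r)
     else P_fun (1 - a) 1 t)"

definition Omega :: "real \<Rightarrow> (real \<times> real) set" where
  "Omega r = {(t, y) \<in> {0..1} \<times> {1/2..1}. L_fun ((3 - r) / (3 + r)) t \<le> y \<and> y \<le> U_fun r t}"

lemma ev_copula_exponent:
  fixes x y :: real
  assumes "x \<in> {0<..<1}" "y \<in> {0<..<1}"
  shows "ln x / ln (x * y) \<in> {0<..<1}"
    and "1 - ln x / ln (x * y) = ln y / ln (x * y)"
proof -
  have "ln x < 0" "ln y < 0" "ln (x * y) = ln x + ln y"
    using assms by (auto simp: ln_mult)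
  then show "ln x / ln (x * y) \<in> {0<..<1}" "1 - ln x / ln (x * y) = ln y / ln (x * y)"
    by (auto simp: field_simps)
qed

lemma ev_copula_bounds:
  assumes "A \<in> pickands" "x \<in> {0..1}" "y \<in> {0..1}"
  shows "x * y \<le> ev_copula A x y" "ev_copula A x y \<le> min x y"
proof -
  have "x * y \<le> ev_copula A x y \<and> ev_copula A x y \<le> min x y"
  proof (cases "x \<in> {0<..<1} \<and> y \<in> {0<..<1}")
    case True
    define t where "t = ln x / ln (x * y)"
    have t: "t \<in> {0<..<1}" "1 - t = ln y / ln (x * y)"
      using ev_copula_exponent[of x y] True by (auto simp: t_def)
    have A: "t \<le> A t" "1 - t \<le> A t" "A t \<le> 1"
      using assms(1) t(1) by (auto simp: pickands_def)
    have xy: "0 < x * y" "x * y < 1"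
      using True mult_strict_mono[of x 1 y 1] by auto
    then have "ln (x * y) < 0" by simp
    then have "(x * y) powr t = x" "(x * y) powr (1 - t) = y"
      using True by (auto simp: powr_def t(2)) (auto simp: t_def)
    moreover have "(x * y) powr A t \<le> (x * y) powr t" "(x * y) powr A t \<le> (x * y) powr (1 - t)"
        "(x * y) powr 1 \<le> (x * y) powr A t"
      using A xy by (intro powr_mono'; simp)+
    ultimately show ?thesis
      using True xy by (simp add: ev_copula_def t_def)
  next
    case False
    then have "x = 0 \<or> x = 1 \<or> y = 0 \<or> y = 1" using assms by auto
    then show ?thesis using False assms by (auto simp: ev_copula_def)
  qed
  then show "x * y \<le> ev_copula A x y" "ev_copula A x y \<le> min x y" by auto
qed

lemma continuous_on_ev_copula:
  assumes A: "A \<in> pickands"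
  shows "continuous_on ({0..1} \<times> {0..1}) (\<lambda>z. ev_copula A (fst z) (snd z))"
  unfolding continuous_on_def
proof
  fix z :: "real \<times> real" assume z: "z \<in> {0..1} \<times> {0..1}"
  let ?S = "{0..1::real} \<times> {0..1::real}" and ?f = "\<lambda>z. ev_copula A (fst z) (snd z)"
  let ?I = "{0<..<1::real} \<times> {0<..<1::real}"
  show "(?f \<longlongrightarrow> ?f z) (at z within ?S)"
  proof (cases "z \<in> ?I")
    case True
    have "convex_on {0<..<1} A"
      using A by (auto simp: pickands_def intro: convex_on_subset)
    then have cont: "continuous_on {0<..<1} A"
      by (intro convex_on_continuous) auto
    have "continuous_on ?I (\<lambda>z. (fst z * snd z) powr A (ln (fst z) / ln (fst z * snd z)))"
    proof (intro continuous_intros continuous_on_compose2[OF cont])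
      show "(\<lambda>z. ln (fst z) / ln (fst z * snd z)) ` ?I \<subseteq> {0<..<1}"
        using ev_copula_exponent(1) by fastforce
      have "ln (fst w * snd w) \<noteq> 0" if "w \<in> ?I" for w :: "real \<times> real"
        using ev_copula_exponent(1)[of "fst w" "snd w"] that by auto
      then show "\<forall>w\<in>?I. ln (fst w * snd w) \<noteq> 0" by blast
    qed auto
    then have "continuous_on ?I ?f"
      by (rule continuous_on_eq) (auto simp: ev_copula_def)
    moreover have "open ?I" by (intro open_Times) auto
    ultimately have "isCont ?f z"
      using True continuous_on_eq_continuous_at by blast
    then show ?thesis
      by (meson isCont_def tendsto_within_subset subset_UNIV)
  next
    case False
    then have b: "fst z = 0 \<or> fst z = 1 \<or> snd z = 0 \<or> snd z = 1"
      using z by (cases z) auto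
    have fz: "?f z = min (fst z) (snd z)" "fst z * snd z = min (fst z) (snd z)"
      using False b z by (auto simp: ev_copula_def mem_Times_iff)
    have lim: "((\<lambda>w. fst w * snd w) \<longlongrightarrow> fst z * snd z) (at z within ?S)"
        "((\<lambda>w. min (fst w) (snd w)) \<longlongrightarrow> min (fst z) (snd z)) (at z within ?S)"
      by (intro tendsto_intros)+
    have bnd: "fst w * snd w \<le> ?f w" "?f w \<le> min (fst w) (snd w)" if "w \<in> ?S" for w
    proof -
      have "fst w \<in> {0..1}" "snd w \<in> {0..1}" using that by (simp_all only: mem_Times_iff)
      then show "fst w * snd w \<le> ?f w" "?f w \<le> min (fst w) (snd w)"
        by (rule ev_copula_bounds[OF A])+
    qed
    have ev: "\<forall>\<^sub>F w in at z within ?S. fst w * snd w \<le> ?f w"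
        "\<forall>\<^sub>F w in at z within ?S. ?f w \<le> min (fst w) (snd w)"
      unfolding eventually_at_filter by (rule always_eventually, use bnd in blast)+
    show ?thesis
      unfolding fz(1)
      by (rule tendsto_sandwich[OF ev lim(1)[unfolded fz(2)] lim(2)])
  qed
qed

end

theory Submission
  imports Defs "HOL-Real_Asymp.Real_Asymp"
begin

text \<open>
  The copula enters only through the formula
  \<open>\<rho> = 12 J(A) - 3\<close> with \<open>J(A) = \<integral> 1 / (1 + A t)\<^sup>2\<close> over \<open>[0,1]\<close>
  (\<open>spearman_rho_ev_copula\<close>), which shows that \<open>\<rho>\<close> decreases as \<open>A\<close> increases. So if
  \<open>A t = y\<close>, then \<open>\<rho>\<close> is at least its value at the largest Pickands function through
  \<open>(t, y)\<close>, and at most its largest value on the minimal ones.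

  The largest function through \<open>(t, y)\<close> is the tent formed by the two chords from \<open>(t, y)\<close> to
  \<open>(0, 1)\<close> and \<open>(1, 1)\<close>. Its \<open>\<rho>\<close> is \<open>6 / (1 + y) - 3\<close>, whatever \<open>t\<close> is
  (\<open>spearman_rho_tent\<close>), so \<open>\<rho> = r\<close> forces \<open>y \<ge> (3 - r) / (3 + r)\<close>: this is the
  lower bound.

  For the upper bound, a supporting line \<open>\<alpha> + \<beta> s\<close> of \<open>A\<close> at \<open>t\<close> gives a roof,
  the maximum of \<open>s\<close>, \<open>1 - s\<close> and \<open>\<alpha> + \<beta> s\<close>, below \<open>A\<close> with the same value at \<open>t\<close>, hence with
  \<open>\<rho> \<ge> r\<close>. That inequality for roofs is a quadratic one, \<open>rho_gap r \<alpha> \<beta> \<ge> 0\<close>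
  (\<open>spearman_rho_roof_ge_iff\<close>), and describes a convex region of lines, an ellipse when
  \<open>r < 1\<close>. Maximizing \<open>\<alpha> + \<beta> t\<close> over this ellipse gives the square root in the
  middle branch of \<open>U_fun\<close>: it is the discriminant condition for some slope to exist
  (\<open>rho_gap_discriminant\<close>). A roof must also satisfy \<open>\<alpha> \<le> 1\<close> and
  \<open>\<alpha> + \<beta> \<le> 1\<close>. For \<open>t\<close> near \<open>0\<close> the first constraint is active, the optimum is the
  point of the ellipse with \<open>\<alpha> = 1\<close> and \<open>\<beta> = - 2 r / (3 - r)\<close>, and the tangent to the ellipse
  there proves optimality (\<open>rho_gap_tangent\<close>); \<open>t\<close> near \<open>1\<close> follows by reflection.

  Every point between the bounds is attained. The tent through the point has
  \<open>\<rho> \<le> r\<close>, and an optimal roof, with its line lowered to pass through the point, has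
  \<open>\<rho> \<ge> r\<close>. Their mixtures all pass through the point and \<open>\<rho>\<close> is continuous in the mixing
  weight, so some mixture has \<open>\<rho> = r\<close> (\<open>pickands_rho_intermediate\<close>).
\<close>

section \<open>Pickands functions\<close>

lemma pickands_ge: "A \<in> pickands \<Longrightarrow> t \<in> {0..1} \<Longrightarrow> t \<le> A t \<and> 1 - t \<le> A t"
  and pickands_le: "A \<in> pickands \<Longrightarrow> t \<in> {0..1} \<Longrightarrow> A t \<le> 1"
  and pickands_half: "A \<in> pickands \<Longrightarrow> t \<in> {0..1} \<Longrightarrow> 1/2 \<le> A t"
  and pickands_convex: "A \<in> pickands \<Longrightarrow> convex_on {0..1} A"
  by (auto simp: pickands_def)

text \<open>Convexity gives continuity on the open interval only. At the endpoints \<open>A\<close> is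
  squeezed between \<open>max s (1 - s)\<close> and \<open>1\<close>.\<close>

lemma pickands_continuous:
  assumes "A \<in> pickands" shows "continuous_on {0..1} A"
  unfolding continuous_on_def
proof
  fix t :: real assume t: "t \<in> {0..1}"
  show "(A \<longlongrightarrow> A t) (at t within {0..1})"
  proof (cases "t \<in> {0<..<1}")
    case True
    have "convex_on {0<..<1} A"
      using pickands_convex[OF assms] by (rule convex_on_subset) auto
    then have "continuous_on {0<..<1} A" by (intro convex_on_continuous) auto
    then have "isCont A t" using True by (simp add: continuous_on_eq_continuous_at)
    then show ?thesis by (meson isCont_def tendsto_within_subset subset_UNIV)
  next
    case False
    then have e: "t = 0 \<or> t = 1" using t by auto
    then have v: "A t = max t (1 - t)" "A t = 1"
      using pickands_ge[OF assms t] pickands_le[OF assms t] by auto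
    have l: "((\<lambda>s. max s (1 - s)) \<longlongrightarrow> A t) (at t within {0..1})"
      unfolding v(1) by (intro tendsto_intros)
    have u: "((\<lambda>s. 1) \<longlongrightarrow> A t) (at t within {0..1})"
      unfolding v(2) by (intro tendsto_intros)
    have "\<forall>\<^sub>F s in at t within {0..1}. max s (1 - s) \<le> A s"
      "\<forall>\<^sub>F s in at t within {0..1}. A s \<le> 1"
      unfolding eventually_at_filter
      by (rule always_eventually, use pickands_ge[OF assms] pickands_le[OF assms] in auto)+
    then show ?thesis by (rule tendsto_sandwich[OF _ _ l u])
  qed
qed

lemma pickandsI:
  assumes "convex_on {0..1} A" "\<And>t. t \<in> {0..1} \<Longrightarrow> max t (1 - t) \<le> A t"
    "\<And>t. t \<in> {0..1} \<Longrightarrow> A t \<le> 1"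
  shows "A \<in> pickands"
proof -
  have "1/2 \<le> A t" if "t \<in> {0..1}" for t using assms(2)[OF that] by auto
  then show ?thesis using assms by (auto simp: pickands_def)
qed

lemma convex_on_max:
  assumes "convex_on S f" "convex_on S g"
  shows "convex_on S (\<lambda>x. max (f x) (g x))"
proof (rule convex_onI)
  fix u :: real and x y assume u: "0 < u" "u < 1" and xy: "x \<in> S" "y \<in> S"
  let ?z = "(1 - u) *\<^sub>R x + u *\<^sub>R y"
  have "f ?z \<le> (1 - u) * f x + u * f y" "g ?z \<le> (1 - u) * g x + u * g y"
    using convex_onD[OF assms(1), of u x y] convex_onD[OF assms(2), of u x y] u xy by auto
  moreover have "(1 - u) * f x \<le> (1 - u) * max (f x) (g x)" "u * f y \<le> u * max (f y) (g y)"
    "(1 - u) * g x \<le> (1 - u) * max (f x) (g x)" "u * g y \<le> u * max (f y) (g y)"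
    using u by (auto intro!: mult_left_mono)
  ultimately show "max (f ?z) (g ?z) \<le> (1 - u) * max (f x) (g x) + u * max (f y) (g y)"
    by linarith
qed (use assms(1) in \<open>rule convex_on_imp_convex\<close>)

lemma convex_on_affine: "convex S \<Longrightarrow> convex_on S (\<lambda>x::real. k + m * x)"
  by (rule convex_onI) (auto simp: algebra_simps)

section \<open>Spearman's rho as a one-dimensional integral\<close>

definition pickands_integral :: "(real \<Rightarrow> real) \<Rightarrow> real" where
  "pickands_integral A = integral {0..1} (\<lambda>t. 1 / (1 + A t)\<^sup>2)"

lemma pickands_integrand_continuous:
  assumes "A \<in> pickands" shows "continuous_on {0..1} (\<lambda>t. 1 / (1 + A t)\<^sup>2)"
proof -
  have "1 + A t \<noteq> 0" if "t \<in> {0..1}" for t using pickands_half[OF assms that] by linarith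
  then show ?thesis by (intro continuous_intros pickands_continuous[OF assms]) auto
qed

lemma pickands_has_integral:
  assumes "A \<in> pickands"
  shows "((\<lambda>t. 1 / (1 + A t)\<^sup>2) has_integral pickands_integral A) {0..1}"
  unfolding pickands_integral_def
  by (intro integrable_integral integrable_continuous_real pickands_integrand_continuous assms)

text \<open>The inner integral that remains after the order of integration is exchanged in
  \<open>spearman_rho_ev_copula\<close>. Integration by parts gives the antiderivative
  \<open>x powr k / k\<^sup>2 - x powr k * ln x / k\<close>, which extends continuously by \<open>0\<close> to
  \<open>x = 0\<close>.\<close>

lemma nn_integral_powr_ln:
  assumes k: "0 < k"
  shows "(\<integral>\<^sup>+x. ennreal (x powr (k - 1) * - ln x) * indicator {0<..<1} x \<partial>lborel) = ennreal (1 / k\<^sup>2)"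
proof -
  define F where "F x = x powr k / k\<^sup>2 - x powr k * ln x / k" for x :: real
  have lim: "(F \<longlongrightarrow> F 0) (at_right 0)"
    unfolding F_def using k by real_asymp
  have cont: "continuous_on {0..1} F"
    unfolding continuous_on_def
  proof
    fix x :: real assume x: "x \<in> {0..1}"
    show "(F \<longlongrightarrow> F x) (at x within {0..1})"
    proof (cases "x = 0")
      case True
      then show ?thesis using lim by (simp add: at_within_Icc_at_right)
    next
      case False
      then have "isCont F x" unfolding F_def using x k by (intro continuous_intros) auto
      then show ?thesis by (meson isCont_def tendsto_within_subset subset_UNIV)
    qed
  qed
  have "((\<lambda>x. x powr (k - 1) * - ln x) has_integral (F 1 - F 0)) {0..1}"
  proof (rule fundamental_theorem_of_calculus_interior)
    fix x :: real assume x: "x \<in> {0<..<1}"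
    have "(F has_real_derivative x powr (k - 1) * - ln x) (at x)"
      unfolding F_def using x k
      by (auto intro!: derivative_eq_intros simp: powr_diff field_simps power2_eq_square)
    then show "(F has_vector_derivative x powr (k - 1) * - ln x) (at x)"
      by (simp add: has_real_derivative_iff_has_vector_derivative)
  qed (use cont in auto)
  also have "F 1 - F 0 = 1 / k\<^sup>2" using k by (simp add: F_def)
  finally have "((\<lambda>x. x powr (k - 1) * - ln x) has_integral 1 / k\<^sup>2) {0<..<1}"
    by (simp add: has_integral_Icc_iff_Ioo)
  then show ?thesis
    by (intro nn_integral_has_integral_lebesgue') (auto simp: mult_nonneg_nonpos)
qed

text \<open>For fixed \<open>x\<close>, the substitution \<open>y = x powr ((1 - t) / t)\<close> inverts
  \<open>t = ln x / ln (x * y)\<close>. It maps \<open>(0,1)\<close> onto itself and turns the copula into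
  \<open>x powr (A t / t)\<close>, so that \<open>A\<close> is evaluated at the integration variable.\<close>

lemma nn_integral_ev_copula_section:
  assumes A: "A \<in> pickands" and x: "x \<in> {0<..<1}"
  shows "(\<integral>\<^sup>+y. ennreal (ev_copula A x y) * indicator {0<..<1} y \<partial>lborel) =
    (\<integral>\<^sup>+t. ennreal (x powr ((1 + A t) / t - 1) * - ln x / t\<^sup>2) * indicator {0<..<1} t \<partial>lborel)"
proof -
  define g where "g t = x powr ((1 - t) / t)" for t
  define h where "h t = x powr ((1 - t) / t) * - ln x / t\<^sup>2" for t
  have lx: "ln x < 0" using x by simp
  have g1: "(g has_field_derivative h t) (at t within {0<..<1})" if "t \<in> {0<..<1}" for t
  proof -
    have "((\<lambda>t. (1 - t) / t * ln x) has_field_derivative - ln x / t\<^sup>2) (at t)"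
      using that by (auto intro!: derivative_eq_intros simp: field_simps power2_eq_square)
    then have "((\<lambda>t. exp ((1 - t) / t * ln x)) has_field_derivative
        exp ((1 - t) / t * ln x) * (- ln x / t\<^sup>2)) (at t within {0<..<1})"
      by (rule has_field_derivative_at_within[OF DERIV_fun_exp])
    moreover have "g = (\<lambda>t. exp ((1 - t) / t * ln x))"
      "h t = exp ((1 - t) / t * ln x) * (- ln x / t\<^sup>2)"
      using x by (auto simp: g_def h_def powr_def fun_eq_iff)
    ultimately show ?thesis by simp
  qed
  have gln: "ln (g t) = (1 - t) / t * ln x" for t
    using x by (simp add: g_def ln_powr)
  have inj: "inj_on g {0<..<1}"
  proof (rule inj_onI)
    fix s t :: real assume st: "s \<in> {0<..<1}" "t \<in> {0<..<1}" "g s = g t"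
    then have "(1 - s) / s * ln x = (1 - t) / t * ln x" using gln by metis
    then show "s = t" using st lx by (auto simp: field_simps)
  qed
  have gpos: "g t \<in> {0<..<1}" if "t \<in> {0<..<1}" for t
    using that x lx by (auto simp: g_def powr_def intro!: divide_neg_pos mult_pos_neg)
  have img: "g ` {0<..<1} = {0<..<1}"
  proof (intro equalityI subsetI)
    fix y :: real assume y: "y \<in> {0<..<1}"
    define t where "t = ln x / (ln x + ln y)"
    have ly: "ln y < 0" using y by simp
    have t: "t \<in> {0<..<1}" using lx ly by (auto simp: t_def field_simps)
    have "1 - t = ln y / (ln x + ln y)" using lx ly by (simp add: t_def field_simps)
    then have "(1 - t) / t * ln x = ln y" using lx ly by (simp add: t_def)
    then have "g t = y" using gln[of t] gpos[OF t] y 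
      by (metis exp_ln greaterThanLessThan_iff)
    then show "y \<in> g ` {0<..<1}" using t by blast
  qed (use gpos in auto)
  have C: "ev_copula A x (g t) = x powr (A t / t)" if "t \<in> {0<..<1}" for t
  proof -
    have "x * g t = x powr (1 + (1 - t) / t)" using x by (simp add: g_def powr_add)
    also have "1 + (1 - t) / t = 1 / t" using that by (simp add: field_simps)
    finally have xg: "x * g t = x powr (1 / t)" .
    have "ln x / ln (x * g t) = t" unfolding xg using lx x that by (simp add: ln_powr)
    then show ?thesis using x gpos[OF that] xg by (simp add: ev_copula_def powr_powr)
  qed
  have eq: "\<bar>h t\<bar> * ev_copula A x (g t) = x powr ((1 + A t) / t - 1) * - ln x / t\<^sup>2"
    if "t \<in> {0<..<1}" for t
  proof -
    have "0 \<le> h t"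
      unfolding h_def using lx by (intro divide_nonneg_nonneg mult_nonneg_nonneg) auto
    then have "\<bar>h t\<bar> = h t" by simp
    moreover have "x powr ((1 - t) / t) * x powr (A t / t) = x powr ((1 + A t) / t - 1)"
      unfolding powr_add[symmetric] using that by (simp add: field_simps)
    ultimately show ?thesis by (simp add: C[OF that] h_def ac_simps)
  qed
  have nonneg: "0 \<le> ev_copula A x y" if "y \<in> {0..1}" for y
    using ev_copula_bounds(1)[OF A _ that, of x] x that
    by (meson atLeastAtMost_iff greaterThanLessThan_iff less_imp_le mult_nonneg_nonneg order_trans)
  have "continuous_on {0..1} (\<lambda>y. ev_copula A (fst (x, y)) (snd (x, y)))"
    by (rule continuous_on_compose2[OF continuous_on_ev_copula[OF A], where f = "\<lambda>y. (x, y)"])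
       (use x in \<open>auto intro!: continuous_intros\<close>)
  then have cont: "continuous_on {0..1} (ev_copula A x)" by simp
  define b where "b = integral {0..1} (ev_copula A x)"
  have hi: "(ev_copula A x has_integral b) {0<..<1}"
    unfolding b_def using integrable_integral[OF integrable_continuous_real[OF cont]]
    by (simp add: has_integral_Icc_iff_Ioo)
  then have ai: "ev_copula A x absolutely_integrable_on {0<..<1}"
    using nonneg by (intro nonnegative_absolutely_integrable_1) (auto simp: integrable_on_def)
  have "(\<lambda>t. \<bar>h t\<bar> * ev_copula A x (g t)) absolutely_integrable_on {0<..<1} \<and>
      integral {0<..<1} (\<lambda>t. \<bar>h t\<bar> * ev_copula A x (g t)) = b"
    using has_absolute_integral_change_of_variables_1'[OF _ g1 inj, of "ev_copula A x" b] ai hi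
    by (simp add: img integral_unique)
  then have "((\<lambda>t. \<bar>h t\<bar> * ev_copula A x (g t)) has_integral b) {0<..<1}"
    using set_lebesgue_integral_eq_integral(1) integrable_integral by metis
  then have hi2: "((\<lambda>t. x powr ((1 + A t) / t - 1) * - ln x / t\<^sup>2) has_integral b) {0<..<1}"
    by (rule has_integral_eq[rotated]) (simp add: eq)
  have "(\<integral>\<^sup>+y. ennreal (ev_copula A x y) * indicator {0<..<1} y \<partial>lborel) = ennreal b"
    using hi nonneg by (intro nn_integral_has_integral_lebesgue') auto
  also have "\<dots> = (\<integral>\<^sup>+t. ennreal (x powr ((1 + A t) / t - 1) * - ln x / t\<^sup>2) * indicator {0<..<1} t \<partial>lborel)"
    using hi2 lx
    by (intro nn_integral_has_integral_lebesgue'[symmetric] divide_nonneg_nonneg mult_nonneg_nonneg) auto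
  finally show ?thesis .
qed

text \<open>After the substitution in each section, Tonelli exchanges the integrals, and integrating
  over \<open>x\<close> first gives \<open>1 / (t\<^sup>2 k\<^sup>2)\<close> with \<open>k = (1 + A t) / t\<close>, which is
  \<open>1 / (1 + A t)\<^sup>2\<close>.\<close>

lemma spearman_rho_ev_copula:
  assumes A: "A \<in> pickands"
  shows "spearman_rho (ev_copula A) = 12 * pickands_integral A - 3"
proof -
  let ?S = "{0..1::real} \<times> {0..1::real}" and ?I = "{0<..<1::real}"
  define f where "f z = indicat_real ?S z *\<^sub>R ev_copula A (fst z) (snd z)" for z
  \<comment> \<open>\<open>A\<close> is arbitrary outside \<open>[0,1]\<close>; cut off to the open interval it is Borel measurable.\<close>
  define B where "B t = indicat_real ?I t *\<^sub>R A t" for t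
  define K where "K x t = ennreal (x powr ((1 + B t) / t - 1) * - ln x / t\<^sup>2) *
      indicator ?I t * indicator ?I x" for x t
  have fm[measurable]: "f \<in> borel_measurable borel"
    unfolding f_def by (rule borel_measurable_continuous_on_indicator)
      (auto intro!: continuous_on_ev_copula A borel_closed closed_Times)
  have f0: "0 \<le> f z" for z
  proof (cases "z \<in> ?S")
    case True
    then have z: "fst z \<in> {0..1}" "snd z \<in> {0..1}" by (simp_all only: mem_Times_iff)
    then have "0 \<le> fst z * snd z" by simp
    moreover have "fst z * snd z \<le> ev_copula A (fst z) (snd z)"
      using z by (rule ev_copula_bounds(1)[OF A])
    ultimately show ?thesis by (simp add: f_def)
  qed (simp add: f_def)
  have "continuous_on ?I A"
    by (rule continuous_on_subset[OF pickands_continuous[OF A]]) auto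
  then have [measurable]: "B \<in> borel_measurable borel"
    unfolding B_def by (intro borel_measurable_continuous_on_indicator) auto
  have Km[measurable]: "(\<lambda>z. K (fst z) (snd z)) \<in> borel_measurable (lborel \<Otimes>\<^sub>M lborel)"
    unfolding K_def by measurable
  have Km': "case_prod K \<in> borel_measurable (lborel \<Otimes>\<^sub>M lborel)"
    using Km by (simp add: case_prod_beta')
  have ae: "AE x in lborel. (x \<noteq> 0 \<and> x \<noteq> (1::real))"
    by (intro AE_conjI AE_lborel_singleton)
  have sec: "(\<integral>\<^sup>+y. ennreal (f (x, y)) \<partial>lborel) = (\<integral>\<^sup>+t. K x t \<partial>lborel)"
    if "x \<noteq> 0" "x \<noteq> 1" for x
  proof (cases "x \<in> ?I")
    case True
    have "(\<integral>\<^sup>+y. ennreal (f (x, y)) \<partial>lborel) =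
        (\<integral>\<^sup>+y. ennreal (ev_copula A x y) * indicator ?I y \<partial>lborel)"
      by (rule nn_integral_cong_AE, use ae in eventually_elim)
         (use True in \<open>auto simp: f_def indicator_def\<close>)
    also have "\<dots> = (\<integral>\<^sup>+t. ennreal (x powr ((1 + A t) / t - 1) * - ln x / t\<^sup>2) * indicator ?I t \<partial>lborel)"
      by (rule nn_integral_ev_copula_section[OF A True])
    also have "\<dots> = (\<integral>\<^sup>+t. K x t \<partial>lborel)"
      by (rule nn_integral_cong) (use True in \<open>auto simp: K_def B_def indicator_def\<close>)
    finally show ?thesis .
  next
    case False
    then have "f (x, y) = 0" "K x y = 0" for y
      using that by (auto simp: f_def K_def indicator_def)
    then show ?thesis by simp
  qed
  have colK: "(\<integral>\<^sup>+x. K x t \<partial>lborel) = ennreal (1 / (1 + A t)\<^sup>2) * indicator ?I t" for t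
  proof (cases "t \<in> ?I")
    case True
    define k where "k = (1 + A t) / t"
    have At: "1/2 \<le> A t" using pickands_half[OF A] True by simp
    have k: "0 < k" using At True by (simp add: k_def)
    have "(\<integral>\<^sup>+x. K x t \<partial>lborel) =
       (\<integral>\<^sup>+x. ennreal (1 / t\<^sup>2) * (ennreal (x powr (k - 1) * - ln x) * indicator ?I x) \<partial>lborel)"
      by (rule nn_integral_cong)
         (use True in \<open>auto simp: K_def B_def k_def indicator_def ennreal_mult'[symmetric]\<close>)
    also have "\<dots> = ennreal (1 / t\<^sup>2) * ennreal (1 / k\<^sup>2)"
      by (subst nn_integral_cmult) (auto simp: nn_integral_powr_ln[OF k, simplified])
    also have "\<dots> = ennreal (1 / (1 + A t)\<^sup>2)"
      using True by (simp add: ennreal_mult'[symmetric] k_def power_divide)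
    finally show ?thesis using True by simp
  qed (simp add: K_def)
  have nn: "(\<integral>\<^sup>+z. ennreal (f z) \<partial>lborel) = ennreal (pickands_integral A)"
  proof -
    have "(\<integral>\<^sup>+z. ennreal (f z) \<partial>lborel) = (\<integral>\<^sup>+z. ennreal (f z) \<partial>(lborel \<Otimes>\<^sub>M lborel))"
      by (simp add: lborel_prod)
    also have "\<dots> = (\<integral>\<^sup>+x. \<integral>\<^sup>+y. ennreal (f (x, y)) \<partial>lborel \<partial>lborel)"
      by (rule lborel.nn_integral_fst[symmetric]) (simp add: lborel_prod)
    also have "\<dots> = (\<integral>\<^sup>+x. \<integral>\<^sup>+t. K x t \<partial>lborel \<partial>lborel)"
      by (rule nn_integral_cong_AE, use ae in eventually_elim) (use sec in auto)
    also have "\<dots> = (\<integral>\<^sup>+t. \<integral>\<^sup>+x. K x t \<partial>lborel \<partial>lborel)"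
      by (rule lborel_pair.Fubini'[OF Km', symmetric])
    also have "\<dots> = (\<integral>\<^sup>+t. ennreal (1 / (1 + A t)\<^sup>2) * indicator ?I t \<partial>lborel)"
      by (simp only: colK)
    also have "\<dots> = ennreal (pickands_integral A)"
      using pickands_has_integral[OF A]
      by (intro nn_integral_has_integral_lebesgue') (auto simp: has_integral_Icc_iff_Ioo)
    finally show ?thesis .
  qed
  have J0: "0 \<le> pickands_integral A"
    using has_integral_nonneg[OF pickands_has_integral[OF A]] by simp
  have "(\<integral>z. f z \<partial>lborel) = pickands_integral A"
    using integral_eq_nn_integral[of f lborel] nn f0 J0 by simp
  then show ?thesis
    by (simp add: spearman_rho_def set_lebesgue_integral_def f_def)
qed

lemma pickands_integral_cong:
  assumes "\<And>t. t \<in> {0..1} \<Longrightarrow> A t = B t"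
  shows "pickands_integral A = pickands_integral B"
  unfolding pickands_integral_def by (rule integral_cong) (simp add: assms)

lemma pickands_integral_antimono:
  assumes A: "A \<in> pickands" and B: "B \<in> pickands" and le: "\<And>t. t \<in> {0..1} \<Longrightarrow> A t \<le> B t"
  shows "pickands_integral B \<le> pickands_integral A"
proof (rule has_integral_le[OF pickands_has_integral[OF B] pickands_has_integral[OF A]])
  fix t :: real assume t: "t \<in> {0..1}"
  have "0 < 1 + A t" using pickands_half[OF A t] by simp
  then show "1 / (1 + B t)\<^sup>2 \<le> 1 / (1 + A t)\<^sup>2"
    using le[OF t] by (intro divide_left_mono power_mono mult_pos_pos zero_less_power) auto
qed

lemma spearman_rho_antimono:
  assumes A: "A \<in> pickands" and B: "B \<in> pickands" and le: "\<And>t. t \<in> {0..1} \<Longrightarrow> A t \<le> B t"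
  shows "spearman_rho (ev_copula B) \<le> spearman_rho (ev_copula A)"
  using pickands_integral_antimono[OF assms] A B by (simp add: spearman_rho_ev_copula)

section \<open>Roofs: the minimal Pickands functions\<close>

text \<open>Every integral of a tent or a roof is a sum of such terms. The antiderivative
  \<open>(s - a) / ((k + m * a) * (k + m * s))\<close> also covers \<open>m = 0\<close>.\<close>

lemma has_integral_reciprocal_affine_square:
  fixes a b k m :: real
  assumes ab: "a \<le> b" and pos: "0 < k + m * a" "0 < k + m * b"
  shows "((\<lambda>s. 1 / (k + m * s)\<^sup>2) has_integral (b - a) / ((k + m * a) * (k + m * b))) {a..b}"
proof -
  have p: "0 < k + m * s" if "s \<in> {a..b}" for s
  proof (cases "0 \<le> m")
    case True
    then have "m * a \<le> m * s" using that by (intro mult_left_mono) auto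
    then show ?thesis using pos by linarith
  next
    case False
    then have "m * b \<le> m * s" using that by (intro mult_left_mono_neg) auto
    then show ?thesis using pos by linarith
  qed
  define F where "F s = (s - a) / ((k + m * a) * (k + m * s))" for s
  have "((\<lambda>s. 1 / (k + m * s)\<^sup>2) has_integral (F b - F a)) {a..b}"
  proof (rule fundamental_theorem_of_calculus[OF ab])
    fix s assume s: "s \<in> {a..b}"
    have "(F has_real_derivative 1 / (k + m * s)\<^sup>2) (at s)"
      unfolding F_def using p[OF s] pos
      by (auto intro!: derivative_eq_intros simp: divide_simps power2_eq_square)
         (auto simp: algebra_simps)
    then show "(F has_vector_derivative 1 / (k + m * s)\<^sup>2) (at s within {a..b})"
      using has_real_derivative_iff_has_vector_derivative has_vector_derivative_at_within by metis
  qed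
  then show ?thesis by (simp add: F_def)
qed

text \<open>For admissible lines these are the functions \<open>P_fun x y\<close>, parametrized by the line that carries their
  middle piece instead of by the points where that line meets \<open>1 - s\<close> and \<open>s\<close>. The
  slopes \<open>1\<close> and \<open>- 1\<close>, at which one of these points becomes undefined, then need no convention.\<close>

definition roof :: "real \<Rightarrow> real \<Rightarrow> real \<Rightarrow> real" where
  "roof \<alpha> \<beta> t = max (max t (1 - t)) (\<alpha> + \<beta> * t)"

text \<open>The line is at most \<open>1\<close> at both ends and at least \<open>1/2\<close> in the middle of \<open>[0,1]\<close>. Together
  these conditions imply \<open>\<bar>\<beta>\<bar> \<le> 1\<close>, and they hold for supporting lines of Pickands
  functions.\<close>

definition admissible :: "real \<Rightarrow> real \<Rightarrow> bool" where
  "admissible \<alpha> \<beta> \<longleftrightarrow> \<alpha> \<le> 1 \<and> \<alpha> + \<beta> \<le> 1 \<and> 1 \<le> 2 * \<alpha> + \<beta>"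

lemma roof_pickands:
  assumes "\<alpha> \<le> 1" "\<alpha> + \<beta> \<le> 1"
  shows "roof \<alpha> \<beta> \<in> pickands"
proof (rule pickandsI)
  have "convex_on {0..1} (\<lambda>t::real. 0 + 1 * t)" "convex_on {0..1} (\<lambda>t::real. 1 + (- 1) * t)"
    "convex_on {0..1} (\<lambda>t. \<alpha> + \<beta> * t)"
    by (intro convex_on_affine convex_real_interval)+
  then have "convex_on {0..1} (\<lambda>t. max (max (0 + 1 * t) (1 + (- 1) * t)) (\<alpha> + \<beta> * t))"
    by (intro convex_on_max)
  then show "convex_on {0..1} (roof \<alpha> \<beta>)" by (simp add: roof_def[abs_def])
  fix t :: real assume t: "t \<in> {0..1}"
  then have "(1 - t) * \<alpha> + t * (\<alpha> + \<beta>) \<le> (1 - t) * 1 + t * 1"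
    using assms by (intro add_mono mult_left_mono) auto
  then show "roof \<alpha> \<beta> t \<le> 1" using t by (simp add: roof_def algebra_simps)
qed (simp add: roof_def)

text \<open>The numerator of \<open>12 J - 3 - r\<close> over a positive denominator, for the roof over the line
  \<open>\<alpha> + \<beta> t\<close> with \<open>\<bar>\<beta>\<bar> < 1\<close>: its sign
  decides whether the roof has Spearman's rho at least \<open>r\<close>.\<close>

definition rho_gap :: "real \<Rightarrow> real \<Rightarrow> real \<Rightarrow> real" where
  "rho_gap r \<alpha> \<beta> =
     12 * (2 * (1 + \<beta>) * (1 + \<alpha> - \<beta>) + 2 * (1 - \<beta>) * (1 + \<alpha> + 2 * \<beta>) - 3 * (1 - \<beta>\<^sup>2))
     - (15 + r) * (1 + \<alpha> - \<beta>) * (1 + \<alpha> + 2 * \<beta>)"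

text \<open>With \<open>x\<close> and \<open>y\<close> the points where the line meets \<open>1 - s\<close> and \<open>s\<close>, and with
  \<open>u = 1 / (2 - x)\<close> and \<open>v = 1 / (1 + y)\<close>, the three pieces of the roof contribute
  \<open>u - 1/2\<close>, \<open>u + v - 3 u v\<close> and \<open>v - 1/2\<close>.\<close>

lemma pickands_integral_roof:
  assumes adm: "admissible \<alpha> \<beta>" and \<beta>: "- 1 < \<beta>" "\<beta> < 1"
  shows "0 < (1 + \<alpha> - \<beta>) * (1 + \<alpha> + 2 * \<beta>)"
    "12 * pickands_integral (roof \<alpha> \<beta>) - 3 - r =
       rho_gap r \<alpha> \<beta> / ((1 + \<alpha> - \<beta>) * (1 + \<alpha> + 2 * \<beta>))"
proof -
  define G H where "G = 1 + \<alpha> - \<beta>" and "H = 1 + \<alpha> + 2 * \<beta>"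
  have GH: "0 < G" "0 < H" using adm \<beta> by (auto simp: admissible_def G_def H_def)
  then show "0 < (1 + \<alpha> - \<beta>) * (1 + \<alpha> + 2 * \<beta>)" by (simp add: G_def H_def)
  define x y where "x = (1 - \<alpha>) / (1 + \<beta>)" and "y = \<alpha> / (1 - \<beta>)"
  have x: "0 \<le> x" "x \<le> 1/2" and y: "1/2 \<le> y" "y \<le> 1"
    using adm \<beta> by (auto simp: admissible_def x_def y_def field_simps)
  have xl: "\<alpha> + \<beta> * x = 1 - x" and yl: "\<alpha> + \<beta> * y = y"
    using \<beta> by (auto simp: x_def y_def field_simps)
  have below_x: "\<alpha> + \<beta> * s \<le> 1 - s \<longleftrightarrow> s \<le> x" for s
    using \<beta> by (auto simp: x_def pos_le_divide_eq algebra_simps)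
  have below_y: "s \<le> \<alpha> + \<beta> * s \<longleftrightarrow> s \<le> y" for s
    using \<beta> by (auto simp: y_def pos_le_divide_eq algebra_simps)
  define u v where "u = 1 / (2 - x)" and "v = 1 / (1 + y)"
  have u: "u = (1 + \<beta>) / H" and v: "v = (1 - \<beta>) / G"
    using \<beta> GH by (auto simp: u_def v_def x_def y_def G_def H_def field_simps)
  let ?f = "\<lambda>s. 1 / (1 + roof \<alpha> \<beta> s)\<^sup>2"
  have "(?f has_integral (x - 0) / ((2 + (- 1) * 0) * (2 + (- 1) * x))) {0..x}"
  proof (rule has_integral_eq[OF _ has_integral_reciprocal_affine_square])
    fix s assume s: "s \<in> {0..x}"
    then have "roof \<alpha> \<beta> s = 1 - s" using x below_x[of s] by (auto simp: roof_def)
    then show "1 / (2 + (- 1) * s)\<^sup>2 = ?f s" by simp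
  qed (use x in auto)
  moreover have "(?f has_integral (y - x) / (((1 + \<alpha>) + \<beta> * x) * ((1 + \<alpha>) + \<beta> * y))) {x..y}"
  proof (rule has_integral_eq[OF _ has_integral_reciprocal_affine_square])
    fix s assume s: "s \<in> {x..y}"
    have "1 - s \<le> \<alpha> + \<beta> * s" using below_x[of s] s xl by (cases "s = x") auto
    moreover have "s \<le> \<alpha> + \<beta> * s" using below_y[of s] s by auto
    ultimately have "roof \<alpha> \<beta> s = \<alpha> + \<beta> * s" by (auto simp: roof_def)
    then show "1 / ((1 + \<alpha>) + \<beta> * s)\<^sup>2 = ?f s" by (simp add: add.assoc)
  qed (use x y xl yl in auto)
  moreover have "(?f has_integral (1 - y) / ((1 + 1 * y) * (1 + 1 * 1))) {y..1}"
  proof (rule has_integral_eq[OF _ has_integral_reciprocal_affine_square])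
    fix s assume s: "s \<in> {y..1}"
    have "\<alpha> + \<beta> * s \<le> s" using below_y[of s] s yl by (cases "s = y") auto
    then have "roof \<alpha> \<beta> s = s" using s y by (auto simp: roof_def)
    then show "1 / (1 + 1 * s)\<^sup>2 = ?f s" by simp
  qed (use y in auto)
  ultimately have "(?f has_integral (x - 0) / ((2 + (- 1) * 0) * (2 + (- 1) * x)) +
      ((y - x) / (((1 + \<alpha>) + \<beta> * x) * ((1 + \<alpha>) + \<beta> * y)) +
       (1 - y) / ((1 + 1 * y) * (1 + 1 * 1)))) {0..1}"
    using x y by (intro has_integral_combine[of 0 x 1] has_integral_combine[of x y 1]) auto
  also have "(1 + \<alpha>) + \<beta> * x = 2 - x" using xl by simp
  also have "(1 + \<alpha>) + \<beta> * y = 1 + y" using yl by simp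
  also have "(x - 0) / ((2 + (- 1) * 0) * (2 + (- 1) * x)) +
      ((y - x) / ((2 - x) * (1 + y)) + (1 - y) / ((1 + 1 * y) * (1 + 1 * 1)))
      = 2 * u + 2 * v - 3 * u * v - 1"
    using x y by (simp add: u_def v_def divide_simps) (simp add: algebra_simps)
  finally have "pickands_integral (roof \<alpha> \<beta>) = 2 * u + 2 * v - 3 * u * v - 1"
    unfolding pickands_integral_def by (rule integral_unique)
  then have "12 * pickands_integral (roof \<alpha> \<beta>) - 3 - r = 24 * u + 24 * v - 36 * (u * v) - (15 + r)"
    by simp
  also have "\<dots> = (12 * (2 * (1 + \<beta>) * G + 2 * (1 - \<beta>) * H - 3 * ((1 + \<beta>) * (1 - \<beta>))) - (15 + r) * G * H) / (G * H)"
    unfolding u v using GH by (simp add: divide_simps) (simp add: algebra_simps)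
  also have "(1 + \<beta>) * (1 - \<beta>) = 1 - \<beta>\<^sup>2" by (simp add: power2_eq_square algebra_simps)
  finally show "12 * pickands_integral (roof \<alpha> \<beta>) - 3 - r =
       rho_gap r \<alpha> \<beta> / ((1 + \<alpha> - \<beta>) * (1 + \<alpha> + 2 * \<beta>))"
    by (simp add: rho_gap_def G_def H_def)
qed

text \<open>The only admissible lines with slope \<open>- 1\<close> or \<open>1\<close> are \<open>1 - t\<close> and \<open>t\<close>. Their roof is
  \<open>max t (1 - t)\<close>, which has rho equal to \<open>1\<close>, and \<open>rho_gap\<close> vanishes there, so the
  criterion persists for \<open>r \<le> 1\<close>.\<close>

lemma spearman_rho_roof_ge_iff:
  assumes r: "r \<le> 1" and adm: "admissible \<alpha> \<beta>"
  shows "r \<le> spearman_rho (ev_copula (roof \<alpha> \<beta>)) \<longleftrightarrow> 0 \<le> rho_gap r \<alpha> \<beta>"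
proof -
  have rho: "spearman_rho (ev_copula (roof \<alpha> \<beta>)) = 12 * pickands_integral (roof \<alpha> \<beta>) - 3"
    using adm by (intro spearman_rho_ev_copula roof_pickands) (auto simp: admissible_def)
  consider "- 1 < \<beta>" "\<beta> < 1" | "\<alpha> = 1 \<and> \<beta> = - 1 \<or> \<alpha> = 0 \<and> \<beta> = 1"
    using adm by (auto simp: admissible_def) linarith
  then show ?thesis
  proof cases
    case 1
    have "r \<le> spearman_rho (ev_copula (roof \<alpha> \<beta>)) \<longleftrightarrow> 0 \<le> 12 * pickands_integral (roof \<alpha> \<beta>) - 3 - r"
      by (auto simp: rho)
    also have "\<dots> \<longleftrightarrow> 0 \<le> rho_gap r \<alpha> \<beta>"
      unfolding pickands_integral_roof(2)[OF adm 1]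
      using pickands_integral_roof(1)[OF adm 1] by (simp only: zero_le_divide_iff) auto
    finally show ?thesis .
  next
    case 2
    have "pickands_integral (roof \<alpha> \<beta>) = pickands_integral (roof (1/2) 0)"
      by (rule pickands_integral_cong) (use 2 in \<open>auto simp: roof_def max_def\<close>)
    moreover have "12 * pickands_integral (roof (1/2) 0) - 3 - 1 = 0"
      using pickands_integral_roof(2)[of "1/2" 0 1] by (simp add: admissible_def rho_gap_def)
    moreover have "rho_gap r \<alpha> \<beta> = 0" using 2 by (auto simp: rho_gap_def)
    ultimately show ?thesis using r rho by simp
  qed
qed

text \<open>Inside the interval this is a supporting line of the convex function; at the endpoints
  the lines \<open>1 - s\<close> and \<open>s\<close> serve. The line reaches \<open>1/2\<close> in the middle because its slope
  is at most \<open>1\<close> in absolute value and its value at \<open>t\<close> is at least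
  \<open>max t (1 - t) = 1/2 + \<bar>t - 1/2\<bar>\<close>.\<close>

lemma pickands_support:
  assumes A: "A \<in> pickands" and t: "t \<in> {0..1}"
  obtains \<alpha> \<beta> where "admissible \<alpha> \<beta>" "A t = \<alpha> + \<beta> * t"
    "\<And>s. s \<in> {0..1} \<Longrightarrow> roof \<alpha> \<beta> s \<le> A s"
proof -
  have e: "A 0 = 1" "A 1 = 1" 
    using pickands_ge[OF A, of 0] pickands_le[OF A, of 0] pickands_ge[OF A, of 1] pickands_le[OF A, of 1]
    by auto
  have roof_le: "roof a b s \<le> A s" if "a + b * s \<le> A s" "s \<in> {0..1}" for a b s
    using that pickands_ge[OF A, of s] by (auto simp: roof_def)
  consider "t = 0" | "t = 1" | "0 < t" "t < 1" using t by fastforce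
  then show ?thesis
  proof cases
    case 1
    show ?thesis
      by (rule that[of 1 "- 1"]) (use 1 e roof_le pickands_ge[OF A] in \<open>auto simp: admissible_def\<close>)
  next
    case 2
    show ?thesis
      by (rule that[of 0 1]) (use 2 e roof_le pickands_ge[OF A] in \<open>auto simp: admissible_def\<close>)
  next
    case 3
    define \<beta> where "\<beta> = Inf ((\<lambda>s. (A t - A s) / (t - s)) ` ({t<..} \<inter> {0..1}))"
    define \<alpha> where "\<alpha> = A t - \<beta> * t"
    have sup: "\<alpha> + \<beta> * s \<le> A s" if "s \<in> {0..1}" for s
      using convex_le_Inf_differential[OF pickands_convex[OF A], of t s] that 3
      by (simp add: \<alpha>_def \<beta>_def algebra_simps)
    have ends: "\<alpha> \<le> 1" "\<alpha> + \<beta> \<le> 1" using sup[of 0] sup[of 1] e by auto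
    have At: "t \<le> A t" "1 - t \<le> A t" using pickands_ge[OF A t] by auto
    have "t * (- 1) \<le> t * \<beta>" using ends At by (simp add: \<alpha>_def algebra_simps)
    then have b1: "- 1 \<le> \<beta>" using 3 by (simp only: mult_le_cancel_left)
    have "(1 - t) * \<beta> \<le> (1 - t) * 1" using ends At by (simp add: \<alpha>_def algebra_simps)
    then have b2: "\<beta> \<le> 1" using 3 by (simp only: mult_le_cancel_left)
    have "1 \<le> 2 * \<alpha> + \<beta>"
    proof -
      have "\<bar>\<beta> * (1 - 2 * t)\<bar> \<le> \<bar>1 - 2 * t\<bar>"
        using b1 b2 by (simp add: abs_mult mult_left_le_one_le)
      moreover have "1 + \<bar>1 - 2 * t\<bar> \<le> 2 * A t" using At by (auto simp: abs_if)
      moreover have "2 * \<alpha> + \<beta> = 2 * A t + \<beta> * (1 - 2 * t)" by (simp add: \<alpha>_def algebra_simps)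
      ultimately show ?thesis by linarith
    qed
    then show ?thesis
      using ends sup roof_le by (intro that[of \<alpha> \<beta>]) (auto simp: admissible_def \<alpha>_def)
  qed
qed

section \<open>Optimizing a line over the quadratic constraint\<close>

definition radicand :: "real \<Rightarrow> real \<Rightarrow> real" where
  "radicand r t = 6 - 2 * r - 15 * t * (1 - t) - r * t * (1 - t)"

text \<open>The reflection \<open>t \<mapsto> 1 - t\<close> carries the line \<open>\<alpha> + \<beta> t\<close> to
  \<open>(\<alpha> + \<beta>) - \<beta> t\<close> and preserves the integral.\<close>

lemma rho_gap_mirror: "rho_gap r (\<alpha> + \<beta>) (- \<beta>) = rho_gap r \<alpha> \<beta>"
  by (simp add: rho_gap_def algebra_simps)

lemma radicand_mirror: "radicand r (1 - t) = radicand r t"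
  by (simp add: radicand_def algebra_simps)

lemma radicand_eq: "radicand r t = ((15 + r) * (1 - 2 * t)\<^sup>2 + 9 * (1 - r)) / 4"
  by (simp add: radicand_def power2_eq_square algebra_simps)

lemma radicand_nonneg: "0 \<le> r \<Longrightarrow> r \<le> 1 \<Longrightarrow> 0 \<le> radicand r t"
  by (simp add: radicand_eq)

lemma radicand_pos: "0 \<le> r \<Longrightarrow> r < 1 \<Longrightarrow> 0 < radicand r t"
  unfolding radicand_eq by (intro divide_pos_pos add_nonneg_pos) auto

text \<open>Completing the square in \<open>\<beta>\<close>, with the value \<open>\<alpha> + \<beta> t\<close> held fixed: the
  coefficient of \<open>\<beta>\<^sup>2\<close> in \<open>rho_gap\<close> is then \<open>- radicand r t\<close>. So
  \<open>rho_gap \<ge> 0\<close> requires \<open>Z\<^sup>2 \<le> 16 * radicand r t\<close> when \<open>r < 1\<close>, and solving this for the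
  value gives the middle branch of \<open>U_fun\<close>. Equality determines the optimal slope.\<close>

lemma rho_gap_discriminant:
  fixes r t \<alpha> \<beta> :: real
  defines "Z \<equiv> (15 + r) * (1 + \<alpha> + \<beta> * t) - 24"
  shows "(15 + r) * (4 * radicand r t * rho_gap r \<alpha> \<beta> + (2 * radicand r t * \<beta> + (1 - 2 * t) * Z)\<^sup>2)
    = 9 * (1 - r) * (16 * radicand r t - Z\<^sup>2)"
proof -
  define w where "w = 1 + \<alpha> + \<beta> * t"
  have \<alpha>: "\<alpha> = w - 1 - \<beta> * t" by (simp add: w_def)
  have Z: "Z = (15 + r) * w - 24" by (simp add: Z_def w_def)
  show ?thesis unfolding Z rho_gap_def radicand_def \<alpha> by algebra
qed

text \<open>For \<open>r = 1\<close> the ellipse degenerates to the lines through \<open>(1/2, 1/2)\<close>, and the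
  right side of \<open>rho_gap_discriminant\<close> vanishes, so that this case needs its own argument.\<close>

lemma rho_gap_one: "rho_gap 1 \<alpha> \<beta> = - 4 * (2 * \<alpha> + \<beta> - 1)\<^sup>2"
  unfolding rho_gap_def by algebra

text \<open>The Taylor expansion of \<open>rho_gap\<close> at the point \<open>\<alpha> = 1\<close>,
  \<open>\<beta> = - 2 r / (3 - r)\<close>, multiplied by \<open>(3 - r)\<^sup>2\<close>. The value there is \<open>0\<close>, and the
  second-order part is written as minus a sum of squares with coefficients that are nonnegative for
  \<open>0 \<le> r \<le> 1\<close>.\<close>

lemma rho_gap_corner_expansion:
  fixes r \<alpha> \<beta> :: real
  defines "M \<equiv> (3 - r) * \<beta> + 2 * r"
  shows "(3 - r)\<^sup>2 * rho_gap r \<alpha> \<beta> = 6 * (r - 1) * (3 - r) * ((6 + r) * (\<alpha> - 1) + M)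
      - ((15 + r) * ((3 - r) * (\<alpha> - 1) + M / 2)\<^sup>2 + 9 * (1 - r) / 4 * M\<^sup>2)"
  unfolding rho_gap_def M_def by (simp add: power2_eq_square field_simps)

lemma rho_gap_corner: "r \<noteq> 3 \<Longrightarrow> rho_gap r 1 (- 2 * r / (3 - r)) = 0"
  using rho_gap_corner_expansion[of r 1 "- 2 * r / (3 - r)"] by simp

text \<open>The region \<open>rho_gap \<ge> 0\<close> is convex, hence on one side of its tangent at that point. The
  breakpoint \<open>(3 - r) / (6 + r)\<close> of \<open>U_fun\<close> is the ratio of the coefficients of
  \<open>\<beta>\<close> and \<open>\<alpha>\<close> in its equation: for this \<open>t\<close> the objective
  \<open>\<alpha> + \<beta> t\<close> is constant along the tangent.\<close>

lemma rho_gap_tangent: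
  fixes r \<alpha> \<beta> :: real
  assumes r: "0 \<le> r" "r < 1" and gap: "0 \<le> rho_gap r \<alpha> \<beta>"
  shows "(6 + r) * (\<alpha> - 1) + ((3 - r) * \<beta> + 2 * r) \<le> 0" (is "?L \<le> 0")
proof (rule ccontr)
  define M where "M = (3 - r) * \<beta> + 2 * r"
  assume "\<not> ?L \<le> 0"
  then have "6 * (r - 1) * (3 - r) * ((6 + r) * (\<alpha> - 1) + M) < 0"
    using r unfolding M_def by (intro mult_neg_pos[of _ ?L] mult_neg_pos[of _ "3 - r"]) auto
  moreover have "0 \<le> (15 + r) * ((3 - r) * (\<alpha> - 1) + M / 2)\<^sup>2 + 9 * (1 - r) / 4 * M\<^sup>2"
    using r by simp
  moreover have "0 \<le> (3 - r)\<^sup>2 * rho_gap r \<alpha> \<beta>" using gap by simp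
  ultimately show False
    using rho_gap_corner_expansion[of r \<alpha> \<beta>] unfolding M_def by linarith
qed

text \<open>The formula holds up to and including the breakpoint, because there the radicand is the
  square of \<open>(9 - 3 r) / (6 + r)\<close> and the two branches agree.\<close>

lemma U_fun_left:
  assumes r: "0 \<le> r" "r \<le> 1" and t: "0 \<le> t" "t \<le> (3 - r) / (6 + r)"
  shows "U_fun r t = 1 - 2 * r / (3 - r) * t"
proof (cases "t = (3 - r) / (6 + r)")
  case True
  have "radicand r t = ((9 - 3 * r) / (6 + r))\<^sup>2"
  proof -
    have eq: "1 - 2 * t = 3 * r / (6 + r)" using True r by (simp add: field_simps)
    have "(15 + r) * (3 * r)\<^sup>2 + 9 * (1 - r) * (6 + r)\<^sup>2 = 4 * (9 - 3 * r)\<^sup>2"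
      by algebra
    then show ?thesis
      unfolding radicand_eq eq power_divide using r by (simp add: divide_simps)
  qed
  then have s: "sqrt (radicand r t) = (9 - 3 * r) / (6 + r)" using r by simp
  have le: "(3 - r) / (6 + r) \<le> (3 + 2 * r) / (6 + r)"
    using r by (intro divide_right_mono) auto
  have "U_fun r t = (9 - r + 4 * sqrt (radicand r t)) / (15 + r)"
    using True le by (simp add: U_fun_def Let_def radicand_def)
  also have "\<dots> = (6 - r) / (6 + r)"
    unfolding s using r by (simp add: divide_simps) (simp add: algebra_simps)
  also have "\<dots> = 1 - 2 * r / (3 - r) * t"
    unfolding True using r by (simp add: divide_simps)
  finally show ?thesis .
next
  case False
  define a where "a = (3 - r) / (3 + r)"
  have "(3 - r) / (6 + r) \<le> a"
    unfolding a_def using r by (intro divide_left_mono) auto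
  then have ta: "t \<le> a" "0 < a" using t r by (auto simp: a_def)
  have "U_fun r t = P_fun 0 a t"
    using t False by (simp add: U_fun_def a_def)
  also have "\<dots> = 1 - (1 - a) / a * t"
    using t ta by (auto simp: P_fun_def divide_simps) (auto simp: algebra_simps)
  also have "(1 - a) / a = 2 * r / (3 - r)"
    using r by (simp add: a_def divide_simps)
  finally show ?thesis .
qed

lemma U_fun_middle:
  assumes "(3 - r) / (6 + r) \<le> t" "t \<le> (3 + 2 * r) / (6 + r)"
  shows "U_fun r t = (9 - r + 4 * sqrt (radicand r t)) / (15 + r)"
  using assms by (simp add: U_fun_def Let_def radicand_def)

lemma U_fun_breakpoint_mirror:
  fixes r :: real
  assumes "0 \<le> r" shows "1 - (3 - r) / (6 + r) = (3 + 2 * r) / (6 + r)"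
  using assms by (simp add: field_simps)

lemma U_fun_mirror:
  assumes r: "0 \<le> r" "r \<le> 1" and t: "t \<in> {0..1}"
  shows "U_fun r (1 - t) = U_fun r t"
proof -
  let ?s = "(3 - r) / (6 + r)" and ?s' = "(3 + 2 * r) / (6 + r)"
  note mir = U_fun_breakpoint_mirror[OF r(1)]
  have right: "U_fun r u = U_fun r (1 - u)" if u: "?s' < u" "u \<le> 1" for u
  proof -
    define a where "a = (3 - r) / (3 + r)"
    have "2 * r / (3 + r) \<le> ?s'"
      using r by (simp add: divide_simps) (simp add: algebra_simps)
    also have "2 * r / (3 + r) = 1 - a" using r by (simp add: a_def divide_simps)
    finally have ua: "1 - a < u" "0 < a" using u r by (auto simp: a_def)
    have le: "?s \<le> ?s'" using r by (intro divide_right_mono) auto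
    have "U_fun r u = P_fun (1 - a) 1 u"
      using u le by (simp add: U_fun_def a_def)
    also have "\<dots> = 1 - (1 - a) / a * (1 - u)"
      using u ua by (simp add: P_fun_def divide_simps) (simp add: algebra_simps)
    also have "(1 - a) / a = 2 * r / (3 - r)"
      using r by (simp add: a_def divide_simps)
    also have "1 - 2 * r / (3 - r) * (1 - u) = U_fun r (1 - u)"
      using u mir by (intro U_fun_left[symmetric] r) auto
    finally show ?thesis .
  qed
  consider "?s' < t" | "t < ?s" | "?s \<le> t" "t \<le> ?s'" by linarith
  then show ?thesis
  proof cases
    case 1
    then show ?thesis using right t by simp
  next
    case 2
    then show ?thesis using right[of "1 - t"] t mir by simp
  next
    case 3
    then show ?thesis
      using U_fun_middle[of r t] U_fun_middle[of r "1 - t"] mir by (simp add: radicand_mirror)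
  qed
qed

lemma U_fun_one:
  assumes t: "t \<in> {0..1}" shows "U_fun 1 t = max t (1 - t)"
proof -
  have left: "U_fun 1 u = 1 - u" if "u \<in> {0..1}" "u < 2 / 7" for u
    using U_fun_left[of 1 u] that by simp
  consider "t < 2/7" | "5/7 < t" | "2/7 \<le> t" "t \<le> 5/7" by linarith
  then show ?thesis
  proof cases
    case 1
    then show ?thesis using left[of t] t by simp
  next
    case 2
    then show ?thesis using left[of "1 - t"] U_fun_mirror[of 1 t] t by simp
  next
    case 3
    have "radicand 1 t = (2 * (1 - 2 * t))\<^sup>2"
      by (simp add: radicand_def power2_eq_square algebra_simps)
    then have "sqrt (radicand 1 t) = \<bar>2 * (1 - 2 * t)\<bar>" by (simp only: real_sqrt_abs)
    then show ?thesis using U_fun_middle[of 1 t] 3 by (auto simp: abs_if max_def)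
  qed
qed

text \<open>Left of the breakpoint the bound combines the tangent inequality with \<open>\<alpha> \<le> 1\<close>; in
  the middle it is the discriminant condition. The right branch is the mirror image of the left.\<close>

lemma rho_gap_nonneg_le_U_fun:
  assumes r: "0 \<le> r" "r \<le> 1" and t: "t \<in> {0..1}"
    and adm: "admissible \<alpha> \<beta>" and gap: "0 \<le> rho_gap r \<alpha> \<beta>"
  shows "\<alpha> + \<beta> * t \<le> U_fun r t"
proof (cases "r = 1")
  case True
  have "2 * \<alpha> + \<beta> = 1" using gap True by (simp add: rho_gap_one)
  then have \<alpha>: "\<alpha> = (1 - \<beta>) / 2" by simp
  have \<beta>: "\<bar>\<beta>\<bar> \<le> 1" using adm by (auto simp: admissible_def)
  have "\<alpha> + \<beta> * t = 1 / 2 + \<beta> * (t - 1 / 2)" by (simp add: \<alpha> field_simps)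
  also have "\<beta> * (t - 1 / 2) \<le> \<bar>\<beta>\<bar> * \<bar>t - 1 / 2\<bar>"
    by (metis abs_ge_self abs_mult)
  also have "\<dots> \<le> 1 * \<bar>t - 1 / 2\<bar>" using \<beta> by (intro mult_right_mono) auto
  also have "1 / 2 + 1 * \<bar>t - 1 / 2\<bar> = max t (1 - t)" by (auto simp: max_def abs_if)
  finally show ?thesis using U_fun_one[OF t] True by simp
next
  case False
  then have r1: "r < 1" using r by simp
  let ?s = "(3 - r) / (6 + r)" and ?s' = "(3 + 2 * r) / (6 + r)"
  note mir = U_fun_breakpoint_mirror[OF r(1)]
  have left: "a + b * u \<le> U_fun r u"
    if u: "0 \<le> u" "u < ?s" and g: "0 \<le> rho_gap r a b" and a: "a \<le> 1" for u a b
  proof -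
    define M where "M = (3 - r) * b + 2 * r"
    have tan: "(6 + r) * (a - 1) + M \<le> 0"
      using rho_gap_tangent[OF r(1) r1 g] by (simp add: M_def)
    have u6: "(6 + r) * u \<le> 3 - r" using u r by (simp add: pos_less_divide_eq mult.commute)
    have "(3 - r) * (a - 1) + u * M \<le> 0"
    proof (cases "M \<le> 0")
      case True
      then show ?thesis using r a u
        by (intro add_nonpos_nonpos mult_nonneg_nonpos) auto
    next
      case False
      have "(6 + r) * ((3 - r) * (a - 1) + u * M) = (3 - r) * ((6 + r) * (a - 1)) + (6 + r) * u * M"
        by (simp add: algebra_simps)
      also have "\<dots> \<le> (3 - r) * (- M) + (3 - r) * M"
        using False u6 tan r by (intro add_mono mult_left_mono mult_right_mono) auto
      finally show ?thesis using r by (simp add: mult_le_0_iff)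
    qed
    moreover have "(3 - r) * (1 - 2 * r / (3 - r) * u) = 3 - r - 2 * r * u"
      using r by (simp add: right_diff_distrib)
    ultimately have "(3 - r) * (a + b * u) \<le> (3 - r) * (1 - 2 * r / (3 - r) * u)"
      by (simp add: M_def algebra_simps)
    then have "a + b * u \<le> 1 - 2 * r / (3 - r) * u" using r by (simp add: mult_le_cancel_left)
    then show ?thesis using U_fun_left[OF r] u by simp
  qed
  consider "?s' < t" | "t < ?s" | "?s \<le> t" "t \<le> ?s'" by linarith
  then show ?thesis
  proof cases
    case 1
    have "(\<alpha> + \<beta>) + (- \<beta>) * (1 - t) \<le> U_fun r (1 - t)"
      using 1 t mir gap adm by (intro left) (auto simp: rho_gap_mirror admissible_def)
    then show ?thesis using U_fun_mirror[OF r t] by (simp add: algebra_simps)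
  next
    case 2
    then show ?thesis using left t gap adm by (simp add: admissible_def)
  next
    case 3
    define D where "D = radicand r t"
    define Z where "Z = (15 + r) * (1 + \<alpha> + \<beta> * t) - 24"
    have D: "0 \<le> D" using radicand_nonneg r by (simp add: D_def)
    have "0 \<le> (15 + r) * (4 * D * rho_gap r \<alpha> \<beta> + (2 * D * \<beta> + (1 - 2 * t) * Z)\<^sup>2)"
      using r D gap by simp
    also have "\<dots> = 9 * (1 - r) * (16 * D - Z\<^sup>2)"
      unfolding D_def Z_def by (rule rho_gap_discriminant)
    finally have "Z\<^sup>2 \<le> 16 * D" using r1 by (simp add: zero_le_mult_iff)
    then have "\<bar>Z\<bar> \<le> sqrt (16 * D)" by (rule real_le_rsqrt[of "\<bar>Z\<bar>", simplified])
    then have "Z \<le> 4 * sqrt D" by (simp add: real_sqrt_mult)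
    then have "(15 + r) * (\<alpha> + \<beta> * t) \<le> 9 - r + 4 * sqrt D"
      by (simp add: Z_def algebra_simps)
    then show ?thesis
      using U_fun_middle[OF 3] r by (simp add: D_def pos_le_divide_eq mult.commute)
  qed
qed

text \<open>The lines \<open>1 - t\<close> and \<open>t\<close> lie on the boundary of the feasible region, for every
  \<open>r\<close>.\<close>

lemma U_fun_ge_max:
  assumes r: "0 \<le> r" "r \<le> 1" and t: "t \<in> {0..1}"
  shows "max t (1 - t) \<le> U_fun r t"
  using rho_gap_nonneg_le_U_fun[OF r t, of 1 "- 1"] rho_gap_nonneg_le_U_fun[OF r t, of 0 1]
  by (simp add: rho_gap_def admissible_def)

text \<open>This makes the optimal line of the middle branch admissible. At \<open>t\<close> beyond the
  breakpoint, a feasible line that reaches the value of the corner line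
  \<open>1 - 2 r / (3 - r) t\<close> must have at least the slope of that line: the combination of this
  assumption with the tangent inequality that eliminates \<open>\<alpha>\<close> leaves a positive multiple of
  the slope difference. The tangent inequality then bounds \<open>\<alpha>\<close>.\<close>

lemma rho_gap_steep:
  assumes r: "0 \<le> r" "r < 1" and t: "(3 - r) / (6 + r) < t" "t \<le> 1"
    and gap: "0 \<le> rho_gap r \<alpha> \<beta>" and ge: "1 - 2 * r / (3 - r) * t \<le> \<alpha> + \<beta> * t"
  shows "\<alpha> \<le> 1" "- 1 \<le> \<beta>"
proof -
  define M where "M = (3 - r) * \<beta> + 2 * r"
  have tan: "(6 + r) * (\<alpha> - 1) + M \<le> 0"
    using rho_gap_tangent[OF r gap] by (simp add: M_def)
  have "(3 - r) * (1 - 2 * r / (3 - r) * t) \<le> (3 - r) * (\<alpha> + \<beta> * t)"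
    using ge r by (intro mult_left_mono) auto
  moreover have "(3 - r) * (1 - 2 * r / (3 - r) * t) = 3 - r - 2 * r * t"
    using r by (simp add: right_diff_distrib)
  ultimately have ge': "0 \<le> (3 - r) * (\<alpha> - 1) + t * M"
    by (simp add: M_def algebra_simps)
  have t6: "0 < (6 + r) * t - (3 - r)"
    using t r by (simp add: pos_divide_less_eq mult.commute)
  have "0 \<le> (6 + r) * ((3 - r) * (\<alpha> - 1) + t * M)"
    using ge' r by (intro mult_nonneg_nonneg) auto
  moreover have "(3 - r) * ((6 + r) * (\<alpha> - 1) + M) \<le> 0"
    using tan r by (intro mult_nonneg_nonpos) auto
  ultimately have "0 \<le> (6 + r) * ((3 - r) * (\<alpha> - 1) + t * M) - (3 - r) * ((6 + r) * (\<alpha> - 1) + M)"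
    by linarith
  also have "\<dots> = ((6 + r) * t - (3 - r)) * M" by (simp add: algebra_simps)
  finally have M: "0 \<le> M" using t6 by (simp add: zero_le_mult_iff)
  then have "(6 + r) * (\<alpha> - 1) \<le> 0" using tan by simp
  then show "\<alpha> \<le> 1" using r by (simp add: mult_le_0_iff)
  have "(3 - r) * (- 1) \<le> (3 - r) * \<beta>" using M r by (simp add: M_def)
  then show "- 1 \<le> \<beta>" using r by (simp only: mult_le_cancel_left)
qed

text \<open>The optimal lines. Up to the breakpoint it is the line of the point in \<open>rho_gap_tangent\<close>,
  and beyond the other breakpoint its mirror image. In between, the slope that makes the
  discriminant condition an equality gives a line with \<open>rho_gap = 0\<close>, and \<open>rho_gap_steep\<close>,
  applied to it and to its mirror image, bounds it by \<open>1\<close> at both ends.\<close>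

lemma U_fun_attained:
  assumes r: "0 \<le> r" "r \<le> 1" and t: "t \<in> {0..1}"
  obtains \<alpha> \<beta> where "admissible \<alpha> \<beta>" "0 \<le> rho_gap r \<alpha> \<beta>"
    "\<alpha> + \<beta> * t = U_fun r t"
proof -
  let ?ok = "\<lambda>t \<alpha> \<beta>. admissible \<alpha> \<beta> \<and> 0 \<le> rho_gap r \<alpha> \<beta> \<and> \<alpha> + \<beta> * t = U_fun r t"
  have "\<exists>\<alpha> \<beta>. ?ok t \<alpha> \<beta>"
  proof (cases "r = 1")
    case True
    then have "?ok t 1 (- 1) \<or> ?ok t 0 1"
      by (auto simp: U_fun_one[OF t] rho_gap_one max_def admissible_def)
    then show ?thesis by blast
  next
    case False
    then have r1: "r < 1" using r by simp
    let ?s = "(3 - r) / (6 + r)" and ?s' = "(3 + 2 * r) / (6 + r)"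
    note mir = U_fun_breakpoint_mirror[OF r(1)]
    define b where "b = - 2 * r / (3 - r)"
    have b: "- 1 \<le> b" "b \<le> 0" "rho_gap r 1 b = 0"
      using r r1 rho_gap_corner[of r] by (auto simp: b_def field_simps)
    consider "t \<le> ?s" | "?s' \<le> t" | "?s < t" "t < ?s'" by linarith
    then show ?thesis
    proof cases
      case 1
      then have "?ok t 1 b"
        using U_fun_left[OF r _ 1] t b by (auto simp: b_def admissible_def)
      then show ?thesis by blast
    next
      case 2
      then have "U_fun r (1 - t) = 1 + b * (1 - t)"
        using U_fun_left[OF r, of "1 - t"] t mir by (simp add: b_def)
      then have "?ok t (1 + b) (- b)"
        using U_fun_mirror[OF r t] b by (simp add: rho_gap_mirror admissible_def algebra_simps)
      then show ?thesis by blast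
    next
      case 3
      define S where "S = sqrt (radicand r t)"
      have S: "0 < S" "radicand r t = S\<^sup>2"
        using radicand_pos[OF r(1) r1, of t] by (auto simp: S_def)
      \<comment> \<open>The slope at which the completed square in \<open>rho_gap_discriminant\<close> vanishes.\<close>
      define \<beta> where "\<beta> = (4 * t - 2) / S"
      define \<alpha> where "\<alpha> = U_fun r t - \<beta> * t"
      have U: "\<alpha> + \<beta> * t = U_fun r t" by (simp add: \<alpha>_def)
      have "(15 + r) * U_fun r t = 9 - r + 4 * S"
        using U_fun_middle[of r t] 3 r by (simp add: S_def)
      then have Z: "(15 + r) * (1 + \<alpha> + \<beta> * t) - 24 = 4 * S"
        using U by (simp add: algebra_simps)
      have "2 * S\<^sup>2 * \<beta> + (1 - 2 * t) * (4 * S) = 0"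
        using S by (simp add: \<beta>_def power2_eq_square field_simps)
      then have "(15 + r) * (4 * S\<^sup>2 * rho_gap r \<alpha> \<beta>) = 0"
        using rho_gap_discriminant[of r t \<alpha> \<beta>] unfolding Z S(2) by (simp add: power_mult_distrib)
      then have gap: "rho_gap r \<alpha> \<beta> = 0" using r S by simp
      have corner: "1 - 2 * r / (3 - r) * u \<le> U_fun r u" if "u \<in> {0..1}" for u
        using rho_gap_nonneg_le_U_fun[OF r that, of 1 b] b by (simp add: b_def admissible_def)
      have 1: "\<alpha> \<le> 1" "- 1 \<le> \<beta>"
        using rho_gap_steep[OF r(1) r1 3(1), of \<alpha> \<beta>] corner[OF t] t gap U by auto
      have "\<alpha> + \<beta> \<le> 1" "- 1 \<le> - \<beta>"
      proof -
        have u: "?s < 1 - t" "1 - t \<le> 1" "1 - t \<in> {0..1}" using 3 mir t by auto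
        have "(\<alpha> + \<beta>) + (- \<beta>) * (1 - t) = U_fun r (1 - t)"
          using U U_fun_mirror[OF r t] by (simp add: algebra_simps)
        then show "\<alpha> + \<beta> \<le> 1" "- 1 \<le> - \<beta>"
          using rho_gap_steep[OF r(1) r1 u(1,2), of "\<alpha> + \<beta>" "- \<beta>"] corner[OF u(3)] gap
          by (simp_all add: rho_gap_mirror)
      qed
      moreover have "1 \<le> 2 * \<alpha> + \<beta>"
      proof -
        have "\<bar>\<beta> * (1 - 2 * t)\<bar> \<le> \<bar>1 - 2 * t\<bar>"
          using 1(2) \<open>- 1 \<le> - \<beta>\<close> by (simp add: abs_mult mult_left_le_one_le)
        moreover have "1 + \<bar>1 - 2 * t\<bar> \<le> 2 * U_fun r t"
          using U_fun_ge_max[OF r t] by (auto simp: abs_if)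
        moreover have "2 * \<alpha> + \<beta> = 2 * U_fun r t + \<beta> * (1 - 2 * t)"
          by (simp add: \<alpha>_def algebra_simps)
        ultimately show ?thesis by linarith
      qed
      ultimately have "?ok t \<alpha> \<beta>" using 1 gap U by (simp add: admissible_def)
      then show ?thesis by blast
    qed
  qed
  then show ?thesis using that by blast
qed

section \<open>Tents: the maximal Pickands functions through a point\<close>

text \<open>The maximum of the two chords suffices, instead of a case distinction at \<open>t\<close>, and makes
  convexity evident.\<close>

definition tent :: "real \<Rightarrow> real \<Rightarrow> real \<Rightarrow> real" where
  "tent t y s = max (1 - (1 - y) / t * s) (1 - (1 - y) / (1 - t) * (1 - s))"

lemma tent_left: "s \<le> t \<Longrightarrow> tent t y s = 1 - (1 - y) / t * s"
  and tent_right: "t \<le> s \<Longrightarrow> tent t y s = 1 - (1 - y) / (1 - t) * (1 - s)"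
  if t: "0 < t" "t < 1" and y: "y \<le> 1"
proof -
  have mono: "(1 - y) / t * u \<le> (1 - y) / t * v" "(1 - y) / (1 - t) * u \<le> (1 - y) / (1 - t) * v"
    if "u \<le> v" for u v
    using that t y by (auto intro!: mult_left_mono divide_nonneg_nonneg simp del: times_divide_eq_left)
  have "(1 - y) / t * t = (1 - y) / (1 - t) * (1 - t)" using t by simp
  then show "s \<le> t \<Longrightarrow> tent t y s = 1 - (1 - y) / t * s"
    "t \<le> s \<Longrightarrow> tent t y s = 1 - (1 - y) / (1 - t) * (1 - s)"
    using mono[of s t] mono[of t s] mono[of "1 - t" "1 - s"] mono[of "1 - s" "1 - t"]
    unfolding tent_def by linarith+
qed

lemma tent_apex: "0 < t \<Longrightarrow> t < 1 \<Longrightarrow> y \<le> 1 \<Longrightarrow> tent t y t = y"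
  using tent_left[of t y t] by simp

lemma tent_pickands:
  assumes t: "0 < t" "t < 1" and y: "max t (1 - t) \<le> y" "y \<le> 1"
  shows "tent t y \<in> pickands"
proof (rule pickandsI)
  define m n where "m = (1 - y) / t" and "n = (1 - y) / (1 - t)"
  have mn: "0 \<le> m" "m \<le> 1" "0 \<le> n" "n \<le> 1" using t y by (auto simp: m_def n_def)
  have tent: "tent t y s = max (1 + (- m) * s) ((1 - n) + n * s)" for s
    unfolding tent_def m_def[symmetric] n_def[symmetric] by (simp add: algebra_simps)
  show "convex_on {0..1} (tent t y)"
    unfolding tent[abs_def] by (intro convex_on_max convex_on_affine convex_real_interval)
  fix s :: real assume s: "s \<in> {0..1}"
  have "m * s \<le> s" "n * (1 - s) \<le> 1 - s" using mn s by (auto intro: mult_left_le_one_le)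
  then have "1 - s \<le> 1 + (- m) * s" "s \<le> (1 - n) + n * s" by (simp_all add: algebra_simps)
  then show "max s (1 - s) \<le> tent t y s" unfolding tent by linarith
  have "0 \<le> m * s" "0 \<le> n * (1 - s)" using mn s by auto
  then show "tent t y s \<le> 1" unfolding tent by (simp add: algebra_simps)
qed

text \<open>The two pieces contribute \<open>t / (2 * (1 + y))\<close> and \<open>(1 - t) / (2 * (1 + y))\<close>, so the
  position of the apex cancels.\<close>

lemma spearman_rho_tent:
  assumes t: "0 < t" "t < 1" and y: "max t (1 - t) \<le> y" "y \<le> 1"
  shows "spearman_rho (ev_copula (tent t y)) = 6 / (1 + y) - 3"
proof -
  let ?f = "\<lambda>s. 1 / (1 + tent t y s)\<^sup>2"
  define m n where "m = - ((1 - y) / t)" and "n = (1 - y) / (1 - t)"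
  have y0: "0 < y" using t y by simp
  have m: "2 + m * t = 1 + y" using t by (simp add: m_def)
  have n: "(2 - n) + n * t = 1 + y"
  proof -
    have "n * (1 - t) = 1 - y" using t by (simp add: n_def)
    then show ?thesis by (simp add: algebra_simps)
  qed
  have "(?f has_integral (t - 0) / ((2 + m * 0) * (2 + m * t))) {0..t}"
  proof (rule has_integral_eq[OF _ has_integral_reciprocal_affine_square])
    fix s assume "s \<in> {0..t}"
    then show "1 / (2 + m * s)\<^sup>2 = ?f s" using tent_left[OF t y(2), of s] by (simp add: m_def)
  qed (use t y0 m in auto)
  moreover have "(?f has_integral (1 - t) / (((2 - n) + n * t) * ((2 - n) + n * 1))) {t..1}"
  proof (rule has_integral_eq[OF _ has_integral_reciprocal_affine_square])
    fix s assume "s \<in> {t..1}"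
    then have "tent t y s = 1 - n * (1 - s)" using tent_right[OF t y(2), of s] by (simp add: n_def)
    then have "(2 - n) + n * s = 1 + tent t y s" by (simp add: algebra_simps)
    then show "1 / ((2 - n) + n * s)\<^sup>2 = ?f s" by (simp only:)
  qed (use t y0 n in auto)
  ultimately have "(?f has_integral (t - 0) / ((2 + m * 0) * (2 + m * t)) +
      (1 - t) / (((2 - n) + n * t) * ((2 - n) + n * 1))) {0..1}"
    using t by (intro has_integral_combine[of 0 t 1]) auto
  then have "pickands_integral (tent t y) = t / (2 * (1 + y)) + (1 - t) / ((1 + y) * 2)"
    unfolding pickands_integral_def m n by (simp add: integral_unique)
  also have "\<dots> = 1 / (2 * (1 + y))" using y0 by (simp add: field_simps)
  finally have "pickands_integral (tent t y) = 1 / (2 * (1 + y))" .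
  then show ?thesis
    unfolding spearman_rho_ev_copula[OF tent_pickands[OF assms]] using y0 by (simp add: field_simps)
qed

lemma pickands_le_tent:
  assumes A: "A \<in> pickands" and t: "0 < t" "t < 1" and s: "s \<in> {0..1}"
  shows "A s \<le> tent t (A t) s"
proof -
  have At: "A t \<le> 1" using pickands_le[OF A] t by simp
  have e: "A 0 \<le> 1" "A 1 \<le> 1" using pickands_le[OF A] by auto
  show ?thesis
  proof (cases "s \<le> t")
    case True
    have "A ((1 - s / t) *\<^sub>R 0 + (s / t) *\<^sub>R t) \<le> (1 - s / t) * A 0 + s / t * A t"
      using True t s by (intro convex_onD[OF pickands_convex[OF A]]) auto
    also have "(1 - s / t) * A 0 \<le> (1 - s / t) * 1"
      using True t e by (intro mult_left_mono) auto
    also have "(1 - s / t) * 1 + s / t * A t = 1 - (1 - A t) / t * s"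
      using t by (simp add: field_simps)
    finally show ?thesis using t by (simp add: tent_left[OF t At True])
  next
    case False
    define u where "u = (s - t) / (1 - t)"
    have u: "0 \<le> u" "u \<le> 1" using False t s by (auto simp: u_def)
    have "u * (1 - t) = s - t" using t by (simp add: u_def)
    then have su: "s = (1 - u) * t + u" by (simp add: algebra_simps)
    have "A ((1 - u) *\<^sub>R t + u *\<^sub>R 1) \<le> (1 - u) * A t + u * A 1"
      using u t by (intro convex_onD[OF pickands_convex[OF A]]) auto
    also have "u * A 1 \<le> u * 1" using u e by (intro mult_left_mono) auto
    finally have "A s \<le> (1 - u) * A t + u" using su by simp
    also have "\<dots> = 1 - (1 - A t) * (1 - u)" by (simp add: algebra_simps)
    also have "1 - u = (1 - s) / (1 - t)" using t by (simp add: u_def field_simps)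
    finally show ?thesis using tent_right[OF t At, of s] False by simp
  qed
qed

section \<open>The two bounds and their sharpness\<close>

lemma L_fun_eq: "1/2 \<le> a \<Longrightarrow> L_fun a t = max a (max t (1 - t))"
  by (auto simp: L_fun_def)

text \<open>Compare \<open>A\<close> with the tent above it for the lower bound, and with the roof over a
  supporting line below it for the upper bound.\<close>

lemma pickands_rho_bounds:
  assumes r: "0 \<le> r" "r \<le> 1" and A: "A \<in> pickands_rho r" and t: "t \<in> {0..1}"
  shows "L_fun ((3 - r) / (3 + r)) t \<le> A t" "A t \<le> U_fun r t"
proof -
  have A: "A \<in> pickands" and rho: "spearman_rho (ev_copula A) = r"
    using A by (auto simp: pickands_rho_def)
  have a: "1/2 \<le> (3 - r) / (3 + r)" "(3 - r) / (3 + r) \<le> 1" using r by (auto simp: field_simps)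
  have "(3 - r) / (3 + r) \<le> A t"
  proof (cases "0 < t \<and> t < 1")
    case True
    then have At: "max t (1 - t) \<le> A t" "A t \<le> 1"
      using pickands_ge[OF A t] pickands_le[OF A t] by auto
    have "6 / (1 + A t) - 3 \<le> r"
      using spearman_rho_antimono[OF A tent_pickands[of t "A t"]] spearman_rho_tent[of t "A t"]
        pickands_le_tent[OF A] True At rho by auto
    then have "6 \<le> (3 + r) * (1 + A t)"
      using pickands_half[OF A t] by (simp add: pos_divide_le_eq diff_le_eq add.commute)
    then show ?thesis using r by (simp add: pos_divide_le_eq algebra_simps)
  next
    case False
    then have "t = 0 \<or> t = 1" using t by auto
    then have "1 \<le> A t" using pickands_ge[OF A t] by auto
    then show ?thesis using a by simp
  qed
  then show "L_fun ((3 - r) / (3 + r)) t \<le> A t"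
    using a pickands_ge[OF A t] by (simp add: L_fun_eq)
  obtain \<alpha> \<beta> where s: "admissible \<alpha> \<beta>" "A t = \<alpha> + \<beta> * t" "\<And>s. s \<in> {0..1} \<Longrightarrow> roof \<alpha> \<beta> s \<le> A s"
    using pickands_support[OF A t] by blast
  have "r \<le> spearman_rho (ev_copula (roof \<alpha> \<beta>))"
    using spearman_rho_antimono[OF roof_pickands A s(3)] s(1) rho by (auto simp: admissible_def)
  then have "0 \<le> rho_gap r \<alpha> \<beta>" using spearman_rho_roof_ge_iff[OF r(2) s(1)] by simp
  then show "A t \<le> U_fun r t"
    using rho_gap_nonneg_le_U_fun[OF r t s(1)] s(2) by simp
qed

lemma pickands_mixture:
  assumes V: "V \<in> pickands" and W: "W \<in> pickands" and s: "s \<in> {0..1}"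
  shows "(\<lambda>x. (1 - s) * V x + s * W x) \<in> pickands"
proof (rule pickandsI)
  show "convex_on {0..1} (\<lambda>x. (1 - s) * V x + s * W x)"
    using s pickands_convex[OF V] pickands_convex[OF W]
    by (intro convex_on_add convex_on_cmul) auto
  fix x :: real assume x: "x \<in> {0..1}"
  have "max x (1 - x) = (1 - s) * max x (1 - x) + s * max x (1 - x)" by (simp add: algebra_simps)
  also have "\<dots> \<le> (1 - s) * V x + s * W x"
    using s pickands_ge[OF V x] pickands_ge[OF W x] by (intro add_mono mult_left_mono) auto
  finally show "max x (1 - x) \<le> (1 - s) * V x + s * W x" .
  have "(1 - s) * V x + s * W x \<le> (1 - s) * 1 + s * 1"
    using s pickands_le[OF V x] pickands_le[OF W x] by (intro add_mono mult_left_mono) auto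
  then show "(1 - s) * V x + s * W x \<le> 1" by simp
qed

text \<open>Every mixture of \<open>V\<close> and \<open>W\<close> is a Pickands function with the value \<open>y\<close> at \<open>t\<close>, and
  the intermediate value theorem in the mixing weight finds one with rho equal to \<open>r\<close>.\<close>

lemma pickands_rho_intermediate:
  assumes V: "V \<in> pickands" and W: "W \<in> pickands" and eq: "V t = y" "W t = y"
    and rho: "spearman_rho (ev_copula V) \<le> r" "r \<le> spearman_rho (ev_copula W)"
  shows "\<exists>A\<in>pickands_rho r. A t = y"
proof -
  define M where "M s x = (1 - s) * V x + s * W x" for s x
  have M: "M s \<in> pickands" if "s \<in> {0..1}" for s
    using pickands_mixture[OF V W that] by (simp add: M_def[abs_def])
  define F where "F s = 12 * pickands_integral (M s) - 3" for s
  have F: "spearman_rho (ev_copula (M s)) = F s" if "s \<in> {0..1}" for s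
    using spearman_rho_ev_copula[OF M[OF that]] by (simp add: F_def)
  have "M 0 = V" "M 1 = W" by (auto simp: M_def)
  then have ends: "F 0 \<le> r" "r \<le> F 1" using F[of 0] F[of 1] rho by auto
  have nz: "1 + M s x \<noteq> 0" if "s \<in> {0..1}" "x \<in> {0..1}" for s x
    using pickands_half[OF M[OF that(1)] that(2)] by linarith
  have c: "continuous_on ({0..1::real} \<times> {0..1::real}) (\<lambda>z. V (snd z))"
    "continuous_on ({0..1::real} \<times> {0..1::real}) (\<lambda>z. W (snd z))"
    by (auto intro!: continuous_on_compose2[OF pickands_continuous[OF V]]
      continuous_on_compose2[OF pickands_continuous[OF W]] continuous_intros)
  have "continuous_on ({0..1} \<times> cbox 0 1) (\<lambda>(s, x). 1 / (1 + M s x)\<^sup>2)"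
    unfolding case_prod_beta' M_def cbox_interval
    by (intro continuous_intros c) (use nz in \<open>auto simp: M_def\<close>)
  then have "continuous_on {0..1} (\<lambda>s. integral (cbox 0 1) (\<lambda>x. 1 / (1 + M s x)\<^sup>2))"
    by (rule integral_continuous_on_param)
  then have "continuous_on {0..1} F"
    unfolding F_def pickands_integral_def cbox_interval by (intro continuous_intros)
  then obtain s where s: "s \<in> {0..1}" "F s = r"
    using IVT'[of F 0 r 1] ends by auto
  have "M s \<in> pickands_rho r" using M[OF s(1)] F[OF s(1)] s(2) by (simp add: pickands_rho_def)
  moreover have "M s t = y" by (simp add: M_def eq algebra_simps)
  ultimately show ?thesis by blast
qed

text \<open>The tent through the point has rho at most \<open>r\<close> because \<open>y \<ge> (3 - r) / (3 + r)\<close>; at the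
  endpoints, where the tent is undefined, the constant function \<open>1\<close> replaces it. For rho at
  least \<open>r\<close>, an optimal line at \<open>t\<close> is lowered by \<open>\<delta>\<close> to pass through the point, which
  can only increase rho.\<close>

lemma pickands_rho_through_point:
  assumes r: "0 \<le> r" "r \<le> 1" and t: "t \<in> {0..1}" and y: "y \<le> 1"
    and L: "L_fun ((3 - r) / (3 + r)) t \<le> y" and U: "y \<le> U_fun r t"
  shows "\<exists>A\<in>pickands_rho r. A t = y"
proof -
  have "1/2 \<le> (3 - r) / (3 + r)" using r by (auto simp: field_simps)
  then have a: "(3 - r) / (3 + r) \<le> y" and m: "max t (1 - t) \<le> y"
    using L by (auto simp: L_fun_eq)
  have "\<exists>V\<in>pickands. V t = y \<and> spearman_rho (ev_copula V) \<le> r"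
  proof (cases "0 < t \<and> t < 1")
    case True
    have "6 \<le> (r + 3) * (1 + y)"
      using a r by (simp add: pos_divide_le_eq algebra_simps)
    then have "6 / (1 + y) \<le> r + 3"
      using m by (subst pos_divide_le_eq) auto
    then show ?thesis
      using True m y tent_pickands tent_apex spearman_rho_tent
      by (intro bexI[of _ "tent t y"]) auto
  next
    case False
    then have "t = 0 \<or> t = 1" using t by auto
    then have y1: "y = 1" using m y by auto
    have one: "(\<lambda>_. 1) \<in> pickands"
      by (rule pickandsI) (auto simp: convex_on_const convex_real_interval)
    then have "spearman_rho (ev_copula (\<lambda>_. 1)) = 0"
      by (simp add: spearman_rho_ev_copula pickands_integral_def)
    then show ?thesis using one y1 r by (intro bexI[of _ "\<lambda>_. 1"]) auto
  qed
  moreover have "\<exists>W\<in>pickands. W t = y \<and> r \<le> spearman_rho (ev_copula W)"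
  proof -
    obtain \<alpha> \<beta> where adm: "admissible \<alpha> \<beta>" and gap: "0 \<le> rho_gap r \<alpha> \<beta>" and v: "\<alpha> + \<beta> * t = U_fun r t"
      using U_fun_attained[OF r t] by blast
    define \<delta> where "\<delta> = U_fun r t - y"
    have \<delta>: "0 \<le> \<delta>" using U by (simp add: \<delta>_def)
    have p: "roof \<alpha> \<beta> \<in> pickands" "roof (\<alpha> - \<delta>) \<beta> \<in> pickands"
      using adm \<delta> by (auto simp: admissible_def intro!: roof_pickands)
    have "r \<le> spearman_rho (ev_copula (roof \<alpha> \<beta>))"
      using spearman_rho_roof_ge_iff[OF r(2) adm] gap by simp
    also have "\<dots> \<le> spearman_rho (ev_copula (roof (\<alpha> - \<delta>) \<beta>))"
      using \<delta> by (intro spearman_rho_antimono p) (auto simp: roof_def)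
    finally have "r \<le> spearman_rho (ev_copula (roof (\<alpha> - \<delta>) \<beta>))" .
    moreover have "roof (\<alpha> - \<delta>) \<beta> t = y" using v m by (auto simp: roof_def \<delta>_def)
    ultimately show ?thesis using p by blast
  qed
  ultimately show ?thesis using pickands_rho_intermediate by blast
qed

theorem theorem2p3:
  fixes rho0 a :: real
  assumes "rho0 \<in> {0..1}"
    and "a = (3 - rho0) / (3 + rho0)"
  shows "a \<in> {1/2..1} \<and>
    (\<forall>A\<in>pickands_rho rho0. \<forall>t\<in>{0..1}. L_fun a t \<le> A t \<and> A t \<le> U_fun rho0 t) \<and>
    (\<forall>(t, y)\<in>Omega rho0. \<exists>A\<in>pickands_rho rho0. A t = y)"
proof (intro conjI)
  have r: "0 \<le> rho0" "rho0 \<le> 1" using assms(1) by auto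
  show "a \<in> {1/2..1}" using r by (auto simp: assms(2) field_simps)
  show "\<forall>A\<in>pickands_rho rho0. \<forall>t\<in>{0..1}. L_fun a t \<le> A t \<and> A t \<le> U_fun rho0 t"
    using pickands_rho_bounds[OF r] assms(2) by blast
  show "\<forall>(t, y)\<in>Omega rho0. \<exists>A\<in>pickands_rho rho0. A t = y"
    using pickands_rho_through_point[OF r] by (auto simp: Omega_def)
qed

end
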